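(* Let $(A,R)$ be a modified Rota-Baxter algebra of weight $\kappa\in\mathbf{k}$ with multiplication $\mu$, and let $(\mu_t,R_t)$, $\mu_t=\sum_{i\ge0}\mu_it^i$, $R_t=\sum_{i\ge0}R_it^i$, be a formal one-parameter deformation of $(A,R)$. Then its infinitesimal $(\mu_1,R_1)$ is a $2$-cocycle in the cohomology complex $\{C^\bullet_{\mathrm{mRBA}}((A,R),(A,R)),\delta_{\mathrm{mRBA}}\}$ of $(A,R)$ with coefficients in itself. Moreover, the cohomology class of $(\mu_1,R_1)$ in $H^2_{\mathrm{mRBA}}((A,R),(A,R))$ depends only on the equivalence class of the deformation $(\mu_t,R_t)$.
   Context: Everything is over a field $\mathbf{k}$ of characteristic $0$; algebras are associative (not necessarily unital). A modified Rota-Baxter algebra of weight $\kappa$ is a pair $(A,R)$ of an algebra $A$ and a linear map $R:A\to A$ with $R(a)R(b)=R(R(a)b+aR(b))+\kappa ab$ for all $a,b\in A$. A morphism $(A,R)\to(A',R')$ is an algebra homomorphism $\varphi$ with $R'\circ\varphi=\varphi\circ R$. A bimodule over $(A,R)$ is a pair $(M,S)$ of an $A$-bimodule $M$ and a linear map $S:M\to M$ with $R(a)\cdot S(u)=S(R(a)\cdot u+a\cdot S(u))+\kappa\,a\cdot u$ and $S(u)\cdot R(a)=S(S(u)\cdot a+u\cdot R(a))+\kappa\,u\cdot a$. "Coefficients in itself" means $(M,S)=(A,R)$ with actions given by multiplication. Cohomology complex. For an algebra $B$ and a $B$-bimodule $N$, $C^n(B,N)=\mathrm{Hom}(B^{\otimes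 n},N)$ ($C^0=N$) and $(\delta_{\mathrm{Hoch}}f)(b_1,\dots,b_{n+1})=(-1)^{n+1}b_1\cdot f(b_2,\dots,b_{n+1})+f(b_1,\dots,b_n)\cdot b_{n+1}+\sum_{i=1}^n(-1)^{i+n+1}f(b_1,\dots,b_ib_{i+1},\dots,b_{n+1})$. Let $A_R$ be $A$ with the associative product $a*_Rb=R(a)b+aR(b)$, and $\widetilde M$ the $A_R$-bimodule with underlying space $M$, left action $(a,u)\mapsto R(a)\cdot u-S(a\cdot u)$ and right action $(u,a)\mapsto u\cdot R(a)-S(u\cdot a)$; let $\widetilde\delta_{\mathrm{Hoch}}$ be the Hochschild differential of $A_R$ with coefficients in $\widetilde M$, and $\delta_{\mathrm{Hoch}}$ that of $A$ with coefficients in $M$. Let $\Psi^0=\mathrm{id}_M$ and, for $n\ge1$, $\Psi^n(f)(a_1,\dots,a_n)=\sum_{I\subseteq\{1,\dots,n\},\,|I|\text{ even}}(-\kappa)^{|I|/2}f(a^I_1,\dots,a^I_n)-\sum_{I\subseteq\{1,\dots,n\},\,|I|\text{ odd}}(-\kappa)^{(|I|-1)/2}S\big(f(a^I_1,\dots,a^I_n)\big)$, where $a^I_j=a_j$ if $j\in I$ and $a^I_j=R(a_j)$ if $j\notin I$. The complex has $C^0_{\mathrm{mRBA}}((A,R),(M,S))=M$, $C^n_{\mathrm{mRBA}}((A,R),(M,S))=\mathrm{Hom}(A^{\otimes n},M)\oplus\mathrm{Hom}(A^{\otimes n-1},M)$ for $n\ge1$, with $\delta_{\mathrm{mRBA}}(u)=(\delta_{\mathrm{Hoch}}(u),-u)$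 and $\delta_{\mathrm{mRBA}}(\chi,\Phi)=(\delta_{\mathrm{Hoch}}(\chi),-\widetilde\delta_{\mathrm{Hoch}}(\Phi)-\Psi^n(\chi))$. Its cohomology is $H^\bullet_{\mathrm{mRBA}}((A,R),(M,S))$. Deformations. A formal one-parameter deformation of $(A,R)$ is a pair $(\mu_t,R_t)$ of formal power series $\mu_t=\sum_{i\ge0}\mu_it^i$ with $\mu_i\in\mathrm{Hom}(A^{\otimes2},A)$, $\mu_0=\mu$, and $R_t=\sum_{i\ge0}R_it^i$ with $R_i\in\mathrm{Hom}(A,A)$, $R_0=R$, such that $A[[t]]$ with the $\mathbf{k}[[t]]$-bilinear multiplication $\mu_t$ is an associative algebra and the $\mathbf{k}[[t]]$-linear map $R_t$ is a modified Rota-Baxter operator of weight $\kappa$ on it. Its infinitesimal is $(\mu_1,R_1)$. Two deformations $(\mu_t,R_t)$ and $(\mu_t',R_t')$ are equivalent if there is a formal isomorphism $\varphi_t=\sum_{i\ge0}\varphi_it^i$, with $\varphi_i\in\mathrm{Hom}(A,A)$ and $\varphi_0=\mathrm{id}_A$, such that $\varphi_t(\mu_t(a,b))=\mu_t'(\varphi_t(a),\varphi_t(b))$ and $\varphi_t\circ R_t=R_t'\circ\varphi_t$. *)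

theory Defs
  imports
    "HOL-Computational_Algebra.Formal_Power_Series"
    "HOL-Library.Function_Algebras"
    "HOL-Library.Product_Plus"
begin

section \<open>Modified Rota-Baxter algebras\<close>

text \<open>
  Algebras are nonunital, with the whole type as carrier.  The scalars form a commutative ring,
  since the notions below are needed over the field \<open>k\<close> and also over \<open>k[[t]]\<close>; over a field,
  \<open>module\<close> has the axioms of \<open>vector_space\<close> and \<open>module_hom\<close> means linear map.
\<close>

definition bilinear_map ::
  "('k::comm_ring_1 \<Rightarrow> 'a::ab_group_add \<Rightarrow> 'a) \<Rightarrow> ('a \<Rightarrow> 'a \<Rightarrow> 'a) \<Rightarrow> bool" where
  "bilinear_map scale \<mu> \<longleftrightarrow>
     (\<forall>a. module_hom scale scale (\<lambda>b. \<mu> a b)) \<and> (\<forall>b. module_hom scale scale (\<lambda>a. \<mu> a b))"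

definition assoc_algebra ::
  "('k::comm_ring_1 \<Rightarrow> 'a::ab_group_add \<Rightarrow> 'a) \<Rightarrow> ('a \<Rightarrow> 'a \<Rightarrow> 'a) \<Rightarrow> bool" where
  "assoc_algebra scale \<mu> \<longleftrightarrow>
     module scale \<and> bilinear_map scale \<mu> \<and> (\<forall>a b c. \<mu> (\<mu> a b) c = \<mu> a (\<mu> b c))"

definition modified_rota_baxter_algebra ::
  "'k::comm_ring_1 \<Rightarrow> ('k \<Rightarrow> 'a::ab_group_add \<Rightarrow> 'a) \<Rightarrow> ('a \<Rightarrow> 'a \<Rightarrow> 'a) \<Rightarrow> ('a \<Rightarrow> 'a) \<Rightarrow> bool" where
  "modified_rota_baxter_algebra \<kappa> scale \<mu> R \<longleftrightarrow>
     assoc_algebra scale \<mu> \<and> module_hom scale scale R \<and>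
     (\<forall>a b. \<mu> (R a) (R b) = R (\<mu> (R a) b + \<mu> a (R b)) + scale \<kappa> (\<mu> a b))"

definition mrba_morphism ::
  "('k::comm_ring_1 \<Rightarrow> 'a::ab_group_add \<Rightarrow> 'a) \<Rightarrow> ('a \<Rightarrow> 'a \<Rightarrow> 'a) \<Rightarrow> ('a \<Rightarrow> 'a) \<Rightarrow>
   ('k \<Rightarrow> 'b::ab_group_add \<Rightarrow> 'b) \<Rightarrow> ('b \<Rightarrow> 'b \<Rightarrow> 'b) \<Rightarrow> ('b \<Rightarrow> 'b) \<Rightarrow> ('a \<Rightarrow> 'b) \<Rightarrow> bool" where
  "mrba_morphism scale \<mu> R scale' \<mu>' R' \<phi> \<longleftrightarrow>
     module_hom scale scale' \<phi> \<and> (\<forall>a b. \<phi> (\<mu> a b) = \<mu>' (\<phi> a) (\<phi> b)) \<and> R' \<circ> \<phi> = \<phi> \<circ> R"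


section \<open>The cohomology complex\<close>

text \<open>
  \<open>Hom (B\<^sup>\<otimes>\<^sup>n, N)\<close> as multilinear functions on lists of length \<open>n\<close>.  They are required to vanish on
  lists of any other length, so that equality of cochains is equality of HOL functions.  For
  \<open>n = 0\<close> this is \<open>N\<close>, the cochain \<open>f\<close> standing for \<open>f []\<close>.
\<close>

definition hom_tensor ::
  "('k::comm_ring_1 \<Rightarrow> 'b::ab_group_add \<Rightarrow> 'b) \<Rightarrow> ('k \<Rightarrow> 'n::ab_group_add \<Rightarrow> 'n) \<Rightarrow> nat \<Rightarrow>
   ('b list \<Rightarrow> 'n) set" where
  "hom_tensor scaleB scaleN n =
     {f. (\<forall>bs. length bs \<noteq> n \<longrightarrow> f bs = 0) \<and>
         (\<forall>bs i. length bs = n \<and> i < n \<longrightarrow> module_hom scaleB scaleN (\<lambda>b. f (bs[i := b])))}"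

text \<open>
  Here \<open>m\<close> is the product of \<open>B\<close>, and \<open>lact\<close>, \<open>ract\<close> are the actions on \<open>N\<close>.  List indices start at
  0: the argument \<open>b\<^sub>i\<close> is \<open>bs ! (i - 1)\<close>.
\<close>

definition hochschild_diff ::
  "('b \<Rightarrow> 'b \<Rightarrow> 'b) \<Rightarrow> ('k::comm_ring_1 \<Rightarrow> 'n::ab_group_add \<Rightarrow> 'n) \<Rightarrow>
   ('b \<Rightarrow> 'n \<Rightarrow> 'n) \<Rightarrow> ('n \<Rightarrow> 'b \<Rightarrow> 'n) \<Rightarrow> nat \<Rightarrow> ('b list \<Rightarrow> 'n) \<Rightarrow> 'b list \<Rightarrow> 'n" where
  "hochschild_diff m scaleN lact ract n f = (\<lambda>bs.
     if length bs = n + 1 then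
       scaleN ((- 1) ^ (n + 1)) (lact (hd bs) (f (tl bs)))
       + ract (f (butlast bs)) (last bs)
       + (\<Sum>i = 1..n. scaleN ((- 1) ^ (i + n + 1))
            (f (take (i - 1) bs @ [m (bs ! (i - 1)) (bs ! i)] @ drop (i + 1) bs)))
     else 0)"

definition star_mult ::
  "('a::ab_group_add \<Rightarrow> 'a \<Rightarrow> 'a) \<Rightarrow> ('a \<Rightarrow> 'a) \<Rightarrow> 'a \<Rightarrow> 'a \<Rightarrow> 'a" where
  "star_mult \<mu> R a b = \<mu> (R a) b + \<mu> a (R b)"

definition tilde_lact ::
  "('a \<Rightarrow> 'a) \<Rightarrow> ('a \<Rightarrow> 'm::ab_group_add \<Rightarrow> 'm) \<Rightarrow> ('m \<Rightarrow> 'm) \<Rightarrow> 'a \<Rightarrow> 'm \<Rightarrow> 'm" where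
  "tilde_lact R lact S a u = lact (R a) u - S (lact a u)"

definition tilde_ract ::
  "('a \<Rightarrow> 'a) \<Rightarrow> ('m::ab_group_add \<Rightarrow> 'a \<Rightarrow> 'm) \<Rightarrow> ('m \<Rightarrow> 'm) \<Rightarrow> 'm \<Rightarrow> 'a \<Rightarrow> 'm" where
  "tilde_ract R ract S u a = ract u (R a) - S (ract u a)"

text \<open>
  The index sets \<open>I\<close> are shifted by one: subsets of \<open>{0..<n}\<close> instead of \<open>{1..n}\<close>.
\<close>

definition mrba_Psi ::
  "'k::comm_ring_1 \<Rightarrow> ('a \<Rightarrow> 'a) \<Rightarrow> ('k \<Rightarrow> 'm::ab_group_add \<Rightarrow> 'm) \<Rightarrow> ('m \<Rightarrow> 'm) \<Rightarrow> nat \<Rightarrow>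
   ('a list \<Rightarrow> 'm) \<Rightarrow> 'a list \<Rightarrow> 'm" where
  "mrba_Psi \<kappa> R scaleM S n f =
     (if n = 0 then f else (\<lambda>as.
        if length as = n then
          (let sub = (\<lambda>I. map (\<lambda>j. if j \<in> I then as ! j else R (as ! j)) [0..<n]) in
            (\<Sum>I | I \<subseteq> {0..<n} \<and> even (card I). scaleM ((- \<kappa>) ^ (card I div 2)) (f (sub I)))
            - (\<Sum>I | I \<subseteq> {0..<n} \<and> odd (card I).
                 scaleM ((- \<kappa>) ^ ((card I - 1) div 2)) (S (f (sub I)))))
        else 0))"

text \<open>
  Cochains in every degree are pairs, so that the complex lives in one type; in degree 0 the second
  component is zero.
\<close>

definition mrba_cochains ::
  "('k::comm_ring_1 \<Rightarrow> 'a::ab_group_add \<Rightarrow> 'a) \<Rightarrow> ('k \<Rightarrow> 'm::ab_group_add \<Rightarrow> 'm) \<Rightarrow> nat \<Rightarrow>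
   (('a list \<Rightarrow> 'm) \<times> ('a list \<Rightarrow> 'm)) set" where
  "mrba_cochains scaleA scaleM n =
     hom_tensor scaleA scaleM n \<times> (if n = 0 then {0} else hom_tensor scaleA scaleM (n - 1))"

definition mrba_diff ::
  "'k::comm_ring_1 \<Rightarrow> ('a::ab_group_add \<Rightarrow> 'a \<Rightarrow> 'a) \<Rightarrow> ('a \<Rightarrow> 'a) \<Rightarrow>
   ('k \<Rightarrow> 'm::ab_group_add \<Rightarrow> 'm) \<Rightarrow> ('a \<Rightarrow> 'm \<Rightarrow> 'm) \<Rightarrow> ('m \<Rightarrow> 'a \<Rightarrow> 'm) \<Rightarrow> ('m \<Rightarrow> 'm) \<Rightarrow> nat \<Rightarrow>
   ('a list \<Rightarrow> 'm) \<times> ('a list \<Rightarrow> 'm) \<Rightarrow> ('a list \<Rightarrow> 'm) \<times> ('a list \<Rightarrow> 'm)" where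
  "mrba_diff \<kappa> \<mu> R scaleM lact ract S n = (\<lambda>(\<chi>, \<Phi>).
     if n = 0 then (hochschild_diff \<mu> scaleM lact ract 0 \<chi>, - \<chi>)
     else (hochschild_diff \<mu> scaleM lact ract n \<chi>,
           - hochschild_diff (star_mult \<mu> R) scaleM (tilde_lact R lact S) (tilde_ract R ract S)
               (n - 1) \<Phi>
           - mrba_Psi \<kappa> R scaleM S n \<chi>))"

definition mrba_cocycles ::
  "'k::comm_ring_1 \<Rightarrow> ('k \<Rightarrow> 'a::ab_group_add \<Rightarrow> 'a) \<Rightarrow> ('a \<Rightarrow> 'a \<Rightarrow> 'a) \<Rightarrow> ('a \<Rightarrow> 'a) \<Rightarrow>
   ('k \<Rightarrow> 'm::ab_group_add \<Rightarrow> 'm) \<Rightarrow> ('a \<Rightarrow> 'm \<Rightarrow> 'm) \<Rightarrow> ('m \<Rightarrow> 'a \<Rightarrow> 'm) \<Rightarrow> ('m \<Rightarrow> 'm) \<Rightarrow> nat \<Rightarrow>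
   (('a list \<Rightarrow> 'm) \<times> ('a list \<Rightarrow> 'm)) set" where
  "mrba_cocycles \<kappa> scaleA \<mu> R scaleM lact ract S n =
     {c \<in> mrba_cochains scaleA scaleM n. mrba_diff \<kappa> \<mu> R scaleM lact ract S n c = 0}"

definition mrba_coboundaries ::
  "'k::comm_ring_1 \<Rightarrow> ('k \<Rightarrow> 'a::ab_group_add \<Rightarrow> 'a) \<Rightarrow> ('a \<Rightarrow> 'a \<Rightarrow> 'a) \<Rightarrow> ('a \<Rightarrow> 'a) \<Rightarrow>
   ('k \<Rightarrow> 'm::ab_group_add \<Rightarrow> 'm) \<Rightarrow> ('a \<Rightarrow> 'm \<Rightarrow> 'm) \<Rightarrow> ('m \<Rightarrow> 'a \<Rightarrow> 'm) \<Rightarrow> ('m \<Rightarrow> 'm) \<Rightarrow> nat \<Rightarrow>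
   (('a list \<Rightarrow> 'm) \<times> ('a list \<Rightarrow> 'm)) set" where
  "mrba_coboundaries \<kappa> scaleA \<mu> R scaleM lact ract S n =
     (if n = 0 then {0}
      else mrba_diff \<kappa> \<mu> R scaleM lact ract S (n - 1) ` mrba_cochains scaleA scaleM (n - 1))"

definition mrba_cohomologous ::
  "'k::comm_ring_1 \<Rightarrow> ('k \<Rightarrow> 'a::ab_group_add \<Rightarrow> 'a) \<Rightarrow> ('a \<Rightarrow> 'a \<Rightarrow> 'a) \<Rightarrow> ('a \<Rightarrow> 'a) \<Rightarrow>
   ('k \<Rightarrow> 'm::ab_group_add \<Rightarrow> 'm) \<Rightarrow> ('a \<Rightarrow> 'm \<Rightarrow> 'm) \<Rightarrow> ('m \<Rightarrow> 'a \<Rightarrow> 'm) \<Rightarrow> ('m \<Rightarrow> 'm) \<Rightarrow> nat \<Rightarrow>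
   (('a list \<Rightarrow> 'm) \<times> ('a list \<Rightarrow> 'm)) rel" where
  "mrba_cohomologous \<kappa> scaleA \<mu> R scaleM lact ract S n =
     {(z, w). z \<in> mrba_cocycles \<kappa> scaleA \<mu> R scaleM lact ract S n \<and>
              w \<in> mrba_cocycles \<kappa> scaleA \<mu> R scaleM lact ract S n \<and>
              z - w \<in> mrba_coboundaries \<kappa> scaleA \<mu> R scaleM lact ract S n}"

definition mrba_cohomology ::
  "'k::comm_ring_1 \<Rightarrow> ('k \<Rightarrow> 'a::ab_group_add \<Rightarrow> 'a) \<Rightarrow> ('a \<Rightarrow> 'a \<Rightarrow> 'a) \<Rightarrow> ('a \<Rightarrow> 'a) \<Rightarrow>
   ('k \<Rightarrow> 'm::ab_group_add \<Rightarrow> 'm) \<Rightarrow> ('a \<Rightarrow> 'm \<Rightarrow> 'm) \<Rightarrow> ('m \<Rightarrow> 'a \<Rightarrow> 'm) \<Rightarrow> ('m \<Rightarrow> 'm) \<Rightarrow> nat \<Rightarrow>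
   (('a list \<Rightarrow> 'm) \<times> ('a list \<Rightarrow> 'm)) set set" where
  "mrba_cohomology \<kappa> scaleA \<mu> R scaleM lact ract S n =
     mrba_cocycles \<kappa> scaleA \<mu> R scaleM lact ract S n
       // mrba_cohomologous \<kappa> scaleA \<mu> R scaleM lact ract S n"

definition mrba_class ::
  "'k::comm_ring_1 \<Rightarrow> ('k \<Rightarrow> 'a::ab_group_add \<Rightarrow> 'a) \<Rightarrow> ('a \<Rightarrow> 'a \<Rightarrow> 'a) \<Rightarrow> ('a \<Rightarrow> 'a) \<Rightarrow>
   ('k \<Rightarrow> 'm::ab_group_add \<Rightarrow> 'm) \<Rightarrow> ('a \<Rightarrow> 'm \<Rightarrow> 'm) \<Rightarrow> ('m \<Rightarrow> 'a \<Rightarrow> 'm) \<Rightarrow> ('m \<Rightarrow> 'm) \<Rightarrow> nat \<Rightarrow>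
   ('a list \<Rightarrow> 'm) \<times> ('a list \<Rightarrow> 'm) \<Rightarrow> (('a list \<Rightarrow> 'm) \<times> ('a list \<Rightarrow> 'm)) set" where
  "mrba_class \<kappa> scaleA \<mu> R scaleM lact ract S n z =
     mrba_cohomologous \<kappa> scaleA \<mu> R scaleM lact ract S n `` {z}"


section \<open>Formal deformations\<close>

text \<open>
  \<open>A[[t]]\<close> is the type \<open>'a fps\<close>, a module over \<open>k[[t]]\<close> via \<open>fps_scale\<close>.  A formal power series of
  (bi)linear maps is its sequence of coefficients; \<open>fps_linear_ext\<close> and \<open>fps_bilinear_ext\<close> are the
  induced \<open>k[[t]]\<close>-(bi)linear maps on \<open>A[[t]]\<close>.
\<close>

definition fps_scale ::
  "('k::comm_ring_1 \<Rightarrow> 'a::ab_group_add \<Rightarrow> 'a) \<Rightarrow> 'k fps \<Rightarrow> 'a fps \<Rightarrow> 'a fps" where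
  "fps_scale scale c x = Abs_fps (\<lambda>n. \<Sum>i\<le>n. scale (fps_nth c i) (fps_nth x (n - i)))"

definition fps_linear_ext ::
  "(nat \<Rightarrow> 'a::ab_group_add \<Rightarrow> 'a) \<Rightarrow> 'a fps \<Rightarrow> 'a fps" where
  "fps_linear_ext f x = Abs_fps (\<lambda>n. \<Sum>i\<le>n. f i (fps_nth x (n - i)))"

definition fps_bilinear_ext ::
  "(nat \<Rightarrow> 'a::ab_group_add \<Rightarrow> 'a \<Rightarrow> 'a) \<Rightarrow> 'a fps \<Rightarrow> 'a fps \<Rightarrow> 'a fps" where
  "fps_bilinear_ext m x y =
     Abs_fps (\<lambda>n. \<Sum>i\<le>n. \<Sum>j\<le>n - i. m i (fps_nth x j) (fps_nth y (n - i - j)))"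

definition formal_deformation ::
  "'k::field_char_0 \<Rightarrow> ('k \<Rightarrow> 'a::ab_group_add \<Rightarrow> 'a) \<Rightarrow> ('a \<Rightarrow> 'a \<Rightarrow> 'a) \<Rightarrow> ('a \<Rightarrow> 'a) \<Rightarrow>
   (nat \<Rightarrow> 'a \<Rightarrow> 'a \<Rightarrow> 'a) \<Rightarrow> (nat \<Rightarrow> 'a \<Rightarrow> 'a) \<Rightarrow> bool" where
  "formal_deformation \<kappa> scale \<mu> R \<mu>t Rt \<longleftrightarrow>
     (\<forall>i. bilinear_map scale (\<mu>t i)) \<and> \<mu>t 0 = \<mu> \<and>
     (\<forall>i. module_hom scale scale (Rt i)) \<and> Rt 0 = R \<and>
     modified_rota_baxter_algebra (fps_const \<kappa>) (fps_scale scale)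
       (fps_bilinear_ext \<mu>t) (fps_linear_ext Rt)"

text \<open>
  Since \<open>\<phi>t 0 = id\<close>, the extension of \<open>\<phi>t\<close> is automatically bijective.
\<close>

definition equivalent_deformations ::
  "('k::field_char_0 \<Rightarrow> 'a::ab_group_add \<Rightarrow> 'a) \<Rightarrow>
   (nat \<Rightarrow> 'a \<Rightarrow> 'a \<Rightarrow> 'a) \<Rightarrow> (nat \<Rightarrow> 'a \<Rightarrow> 'a) \<Rightarrow>
   (nat \<Rightarrow> 'a \<Rightarrow> 'a \<Rightarrow> 'a) \<Rightarrow> (nat \<Rightarrow> 'a \<Rightarrow> 'a) \<Rightarrow> bool" where
  "equivalent_deformations scale \<mu>t Rt \<mu>t' Rt' \<longleftrightarrow>
     (\<exists>\<phi>t. (\<forall>i. module_hom scale scale (\<phi>t i)) \<and> \<phi>t 0 = id \<and>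
        mrba_morphism (fps_scale scale) (fps_bilinear_ext \<mu>t) (fps_linear_ext Rt)
          (fps_scale scale) (fps_bilinear_ext \<mu>t') (fps_linear_ext Rt')
          (fps_linear_ext \<phi>t))"

definition infinitesimal ::
  "(nat \<Rightarrow> 'a::ab_group_add \<Rightarrow> 'a \<Rightarrow> 'a) \<Rightarrow> (nat \<Rightarrow> 'a \<Rightarrow> 'a) \<Rightarrow>
   ('a list \<Rightarrow> 'a) \<times> ('a list \<Rightarrow> 'a)" where
  "infinitesimal \<mu>t Rt =
     (\<lambda>as. if length as = 2 then \<mu>t 1 (as ! 0) (as ! 1) else 0,
      \<lambda>as. if length as = 1 then Rt 1 (as ! 0) else 0)"

end

theory Submission
  imports Defs
begin

text \<open>
  Evaluating the defining identities of a deformation, resp. of an equivalence, on constant power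
  series and comparing the coefficients of \<open>t\<close> gives the cocycle condition, resp. the relation
  \<open>(\<mu>\<^sub>1, R\<^sub>1) - (\<mu>\<^sub>1', R\<^sub>1') = \<delta> (\<phi>\<^sub>1, 0)\<close>.
\<close>

section \<open>Coefficients of degree 0 and 1 in \<open>A[[t]]\<close>\<close>

lemma fps_bilinear_ext_nth_0:
  "fps_nth (fps_bilinear_ext m x y) 0 = m 0 (fps_nth x 0) (fps_nth y 0)"
  by (simp add: fps_bilinear_ext_def)

lemma fps_bilinear_ext_nth_1:
  "fps_nth (fps_bilinear_ext m x y) 1 =
     m 0 (fps_nth x 0) (fps_nth y 1) + m 0 (fps_nth x 1) (fps_nth y 0)
     + m 1 (fps_nth x 0) (fps_nth y 0)"
  by (simp add: fps_bilinear_ext_def)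

lemma fps_linear_ext_nth_0: "fps_nth (fps_linear_ext f x) 0 = f 0 (fps_nth x 0)"
  by (simp add: fps_linear_ext_def)

lemma fps_linear_ext_nth_1:
  "fps_nth (fps_linear_ext f x) 1 = f 0 (fps_nth x 1) + f 1 (fps_nth x 0)"
  by (simp add: fps_linear_ext_def)

text \<open>The weight over \<open>k[[t]]\<close> is the constant series
  \<open>fps_const \<kappa>\<close>, so only the index 0 survives in the convolution. This evaluates
  the weight term of the Rota-Baxter identity.\<close>

lemma fps_scale_const_nth:
  assumes "module scale"
  shows "fps_nth (fps_scale scale (fps_const c) x) n = scale c (fps_nth x n)"
proof -
  have "(\<Sum>i\<le>n. scale (fps_nth (fps_const c) i) (fps_nth x (n - i))) =
      (\<Sum>i\<le>n. if i = 0 then scale c (fps_nth x n) else 0)"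
    by (intro sum.cong) (auto simp: module.scale_zero_left[OF assms])
  then show ?thesis
    by (simp add: fps_scale_def)
qed

lemmas fps_ext_nth =
  fps_bilinear_ext_nth_0 fps_bilinear_ext_nth_1 fps_linear_ext_nth_0 fps_linear_ext_nth_1

lemma bilinear_map_hom:
  assumes "bilinear_map scale m"
  shows "module_hom scale scale (m a)" "module_hom scale scale (\<lambda>a. m a b)"
  using assms by (auto simp: bilinear_map_def)

lemma bilinear_map_simps:
  assumes "bilinear_map scale m"
  shows "m a 0 = 0" "m 0 b = 0" "m a (b + c) = m a b + m a c" "m (a + b) c = m a c + m b c"
    "m a (b - c) = m a b - m a c" "m (a - b) c = m a c - m b c"
  using bilinear_map_hom[OF assms]
  by (auto dest: module_hom.zero module_hom.add module_hom.diff)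

lemma modified_rota_baxter_algebraD:
  assumes "modified_rota_baxter_algebra \<kappa> scale \<mu> R"
  shows "module scale" "bilinear_map scale \<mu>" "module_hom scale scale R"
    "\<mu> (\<mu> a b) c = \<mu> a (\<mu> b c)"
    "\<mu> (R a) (R b) = R (\<mu> (R a) b + \<mu> a (R b)) + scale \<kappa> (\<mu> a b)"
  using assms by (auto simp: modified_rota_baxter_algebra_def assoc_algebra_def)

lemma formal_deformationD:
  assumes "formal_deformation \<kappa> scale \<mu> R \<mu>t Rt"
  shows "bilinear_map scale (\<mu>t i)" "module_hom scale scale (Rt i)" "\<mu>t 0 = \<mu>" "Rt 0 = R"
    "modified_rota_baxter_algebra (fps_const \<kappa>) (fps_scale scale)
       (fps_bilinear_ext \<mu>t) (fps_linear_ext Rt)"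
  using assms by (auto simp: formal_deformation_def)

section \<open>Deformation identities to first order in \<open>t\<close>\<close>

lemma formal_deformation_assoc_1:
  assumes "formal_deformation \<kappa> scale \<mu> R \<mu>t Rt"
  shows "\<mu> (\<mu>t 1 a b) c + \<mu>t 1 (\<mu> a b) c = \<mu> a (\<mu>t 1 b c) + \<mu>t 1 a (\<mu> b c)"
proof -
  note d = formal_deformationD[OF assms]
  \<comment> \<open>Constant series have zero coefficient at \<open>t\<close>, which kills the mixed
    terms. The case of index 0 is also stated for \<open>\<mu>\<close>, because \<open>d(3)\<close>
    rewrites \<open>\<mu>t 0\<close> to \<open>\<mu>\<close>.\<close>
  note z = bilinear_map_simps(1,2)[OF d(1)] bilinear_map_simps(1,2)[OF d(1)[of 0], unfolded d(3)]
  have "fps_nth (fps_bilinear_ext \<mu>t (fps_bilinear_ext \<mu>t (fps_const a) (fps_const b)) (fps_const c)) 1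
      = fps_nth (fps_bilinear_ext \<mu>t (fps_const a) (fps_bilinear_ext \<mu>t (fps_const b) (fps_const c))) 1"
    by (simp only: modified_rota_baxter_algebraD(4)[OF d(5)])
  then show ?thesis
    \<comment> \<open>The simplifier turns the index \<open>1\<close> into \<open>Suc 0\<close>, so
      the coefficient rules must have that form.\<close>
    by (simp add: fps_ext_nth[unfolded One_nat_def] d(3) z)
qed

text \<open>The coefficient of \<open>t\<close> in the weight-\<open>\<kappa>\<close> identity at
  two constant series: each summand differentiates exactly one of the factors \<open>\<mu>t\<close>,
  \<open>Rt\<close>.\<close>

lemma formal_deformation_rota_baxter_1:
  assumes "module scale" "formal_deformation \<kappa> scale \<mu> R \<mu>t Rt"
  shows "\<mu>t 1 (R a) (R b) + \<mu> (Rt 1 a) (R b) + \<mu> (R a) (Rt 1 b) =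
    Rt 1 (\<mu> (R a) b + \<mu> a (R b))
    + R (\<mu>t 1 (R a) b + \<mu> (Rt 1 a) b + \<mu>t 1 a (R b) + \<mu> a (Rt 1 b)) + scale \<kappa> (\<mu>t 1 a b)"
proof -
  note d = formal_deformationD[OF assms(2)]
  note z = bilinear_map_simps(1,2)[OF d(1)] bilinear_map_simps(1,2)[OF d(1)[of 0], unfolded d(3)]
    module_hom.zero[OF d(2)] module_hom.zero[OF d(2)[of 0], unfolded d(4)]
  let ?m = "fps_bilinear_ext \<mu>t" and ?r = "fps_linear_ext Rt"
    and ?a = "fps_const a" and ?b = "fps_const b"
  have "fps_nth (?m (?r ?a) (?r ?b)) 1 =
      fps_nth (?r (?m (?r ?a) ?b + ?m ?a (?r ?b)) + fps_scale scale (fps_const \<kappa>) (?m ?a ?b)) 1"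
    by (simp only: modified_rota_baxter_algebraD(5)[OF d(5)])
  then show ?thesis
    by (simp add: fps_ext_nth[unfolded One_nat_def] d(3,4) z fps_scale_const_nth[OF assms(1)]
        algebra_simps)
qed

section \<open>The infinitesimal as a 2-cocycle\<close>

lemma infinitesimal_cochain:
  fixes scale :: "'k::field_char_0 \<Rightarrow> 'a::ab_group_add \<Rightarrow> 'a"
  assumes "module scale" "formal_deformation \<kappa> scale \<mu> R \<mu>t Rt"
  shows "infinitesimal \<mu>t Rt \<in> mrba_cochains scale scale 2"
proof -
  note d = formal_deformationD[OF assms(2)]
  have "module_hom scale scale (\<lambda>b. \<mu>t 1 (bs[i := b] ! 0) (bs[i := b] ! 1))"
    if "length bs = 2" "i < 2" for bs :: "'a list" and i
    using that bilinear_map_hom[OF d(1)[of 1]] by (cases "i = 0") (auto simp: less_2_cases_iff)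
  moreover have "module_hom scale scale (\<lambda>b. Rt 1 (bs[0 := b] ! 0))"
    if "length bs = 1" for bs :: "'a list"
    using that d(2)[of 1] by simp
  ultimately show ?thesis
    by (auto simp: mrba_cochains_def infinitesimal_def hom_tensor_def)
qed

text \<open>These are the index sets of the two sums in \<open>mrba_Psi\<close> for two
  arguments.\<close>

lemma even_subsets_2: "{I. I \<subseteq> {0..<2::nat} \<and> even (card I)} = {{}, {0, 1}}"
  and odd_subsets_2: "{I. I \<subseteq> {0..<2::nat} \<and> odd (card I)} = {{0}, {1}}"
proof -
  have *: "I \<subseteq> {0..<2} \<longleftrightarrow> I \<in> {{}, {0}, {1}, {0, 1}}" for I :: "nat set"
    using subset_insert_iff by (auto simp: numeral_2_eq_2 atLeast0_lessThan_Suc)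
  show "{I. I \<subseteq> {0..<2::nat} \<and> even (card I)} = {{}, {0, 1}}"
    "{I. I \<subseteq> {0..<2::nat} \<and> odd (card I)} = {{0}, {1}}"
    unfolding * by auto
qed

lemma even_subsets_1: "{I. I \<subseteq> {0..<1::nat} \<and> even (card I)} = {{}}"
  and odd_subsets_1: "{I. I \<subseteq> {0..<1::nat} \<and> odd (card I)} = {{0}}"
  by (auto simp: subset_singleton_iff)

text \<open>The empty set gives the term with \<open>R\<close> on both arguments, the full set gives
  the factor \<open>- \<kappa>\<close>, and each singleton gives an \<open>S\<close> term with
  coefficient 1.\<close>

lemma mrba_Psi_2:
  assumes "module scale"
  shows "mrba_Psi \<kappa> R scale S 2 f [a, b] =
    f [R a, R b] - scale \<kappa> (f [a, b]) - S (f [a, R b]) - S (f [R a, b])"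
proof -
  have u: "[0..<2] = [0, 1::nat]"
    by (simp add: upt_rec)
  \<comment> \<open>The sums run over two-element sets of sets; splitting them requires the two
    elements to be distinct.\<close>
  have ne: "{} \<noteq> {0, 1::nat}" "{0} \<noteq> {1::nat}"
    by auto
  show ?thesis
    unfolding mrba_Psi_def Let_def even_subsets_2 odd_subsets_2
    using ne by (simp add: u module.scale_one[OF assms] module.scale_minus_left[OF assms])
qed

lemma mrba_Psi_1:
  assumes "module scale"
  shows "mrba_Psi \<kappa> R scale S 1 f [a] = f [R a] - S (f [a])"
  unfolding mrba_Psi_def Let_def even_subsets_1 odd_subsets_1
  by (simp add: module.scale_one[OF assms])

lemma hochschild_diff_2:
  assumes "module scale"
  shows "hochschild_diff m scale lact ract 2 f [a, b, c] =
    ract (f [a, b]) c + f [m a b, c] - lact a (f [b, c]) - f [a, m b c]"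
proof -
  have "{1..2} = {1, 2::nat}"
    by auto
  then show ?thesis
    by (simp add: hochschild_diff_def module.scale_one[OF assms] module.scale_minus_left[OF assms])
qed

lemma hochschild_diff_1:
  assumes "module scale"
  shows "hochschild_diff m scale lact ract 1 f [a, b] =
    lact a (f [b]) + ract (f [a]) b - f [m a b]"
  by (simp add: hochschild_diff_def module.scale_one[OF assms] module.scale_minus_left[OF assms])

text \<open>Cochains are functions on all lists, padded by zero. This settles the lists of wrong
  length when cochains are compared pointwise.\<close>

lemma hochschild_diff_eq_0:
  assumes "length bs \<noteq> n + 1"
  shows "hochschild_diff m scale lact ract n f bs = 0"
  using assms by (simp add: hochschild_diff_def)

lemma mrba_Psi_eq_0:
  assumes "n \<noteq> 0" "length bs \<noteq> n"
  shows "mrba_Psi \<kappa> R scale S n f bs = 0"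
  using assms by (simp add: mrba_Psi_def)

text \<open>The first component of the differential is the first-order associativity identity. In
  the second, the tilde Hochschild term collects the summands with \<open>Rt 1\<close> and
  \<open>mrba_Psi\<close> those with \<open>\<mu>t 1\<close>; together they are the first-order
  Rota-Baxter identity.\<close>

lemma infinitesimal_cocycle:
  assumes "modified_rota_baxter_algebra \<kappa> scale \<mu> R" "formal_deformation \<kappa> scale \<mu> R \<mu>t Rt"
  shows "infinitesimal \<mu>t Rt \<in> mrba_cocycles \<kappa> scale \<mu> R scale \<mu> \<mu> R 2"
proof -
  note A = modified_rota_baxter_algebraD[OF assms(1)]
  obtain \<chi> \<Phi> where inf: "infinitesimal \<mu>t Rt = (\<chi>, \<Phi>)"
    by fastforce
  then have \<chi>: "\<chi> [a, b] = \<mu>t 1 a b" and \<Phi>: "\<Phi> [a] = Rt 1 a" for a b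
    by (auto simp: infinitesimal_def)
  have "hochschild_diff \<mu> scale \<mu> \<mu> 2 \<chi> bs = 0" for bs
  proof (cases "length bs = 3")
    case True
    then obtain a b c where "bs = [a, b, c]"
      by (auto simp: length_Suc_conv numeral_3_eq_3)
    then show ?thesis
      using formal_deformation_assoc_1[OF assms(2), of a b c]
      by (simp add: hochschild_diff_2[OF A(1)] \<chi> algebra_simps)
  qed (simp add: hochschild_diff_eq_0)
  moreover have "- hochschild_diff (star_mult \<mu> R) scale (tilde_lact R \<mu> R) (tilde_ract R \<mu> R) 1 \<Phi> bs
      - mrba_Psi \<kappa> R scale R 2 \<chi> bs = 0" for bs
  proof (cases "length bs = 2")
    case True
    then obtain a b where "bs = [a, b]"
      by (auto simp: length_Suc_conv numeral_2_eq_2)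
    then show ?thesis
      using formal_deformation_rota_baxter_1[OF A(1) assms(2), of a b]
      by (simp add: hochschild_diff_1[OF A(1)] mrba_Psi_2[OF A(1)] \<chi> \<Phi> star_mult_def tilde_lact_def
          tilde_ract_def module_hom.add[OF A(3)] algebra_simps del: One_nat_def)
  qed (simp add: hochschild_diff_eq_0 mrba_Psi_eq_0)
  ultimately have "mrba_diff \<kappa> \<mu> R scale \<mu> \<mu> R 2 (\<chi>, \<Phi>) = 0"
    by (simp add: mrba_diff_def zero_prod_def fun_eq_iff)
  then show ?thesis
    using infinitesimal_cochain[OF A(1) assms(2)] by (simp add: mrba_cocycles_def inf)
qed

section \<open>Equivalent deformations have cohomologous infinitesimals\<close>

lemma equivalent_deformations_coboundary:
  fixes scale :: "'k::field_char_0 \<Rightarrow> 'a::ab_group_add \<Rightarrow> 'a"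
  assumes "modified_rota_baxter_algebra \<kappa> scale \<mu> R"
    and "formal_deformation \<kappa> scale \<mu> R \<mu>t Rt" "formal_deformation \<kappa> scale \<mu> R \<mu>t' Rt'"
    and "equivalent_deformations scale \<mu>t Rt \<mu>t' Rt'"
  shows "infinitesimal \<mu>t Rt - infinitesimal \<mu>t' Rt'
    \<in> mrba_coboundaries \<kappa> scale \<mu> R scale \<mu> \<mu> R 2"
proof -
  note A = modified_rota_baxter_algebraD[OF assms(1)]
  note D = formal_deformationD[OF assms(2)] and D' = formal_deformationD[OF assms(3)]
  obtain \<phi>t where hom: "module_hom scale scale (\<phi>t i)" and id: "\<phi>t 0 = id"
    and mult: "fps_linear_ext \<phi>t (fps_bilinear_ext \<mu>t x y) =
      fps_bilinear_ext \<mu>t' (fps_linear_ext \<phi>t x) (fps_linear_ext \<phi>t y)"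
    and comm: "fps_linear_ext Rt' (fps_linear_ext \<phi>t x) = fps_linear_ext \<phi>t (fps_linear_ext Rt x)"
    for i x y
    using assms(4) by (fastforce simp: equivalent_deformations_def mrba_morphism_def fun_eq_iff)
  note z = module_hom.zero[OF hom] bilinear_map_simps(1,2)[OF A(2)] module_hom.zero[OF A(3)]
  \<comment> \<open>Both deformations start with \<open>\<mu>\<close> and
    \<open>\<phi>t 0 = id\<close>, so at \<open>t\<close> the unknown terms besides
    \<open>\<mu>t 1\<close> and \<open>\<mu>t' 1\<close> involve only \<open>\<phi>t 1\<close>. The
    right-hand side is the Hochschild differential of \<open>\<phi>t 1\<close>.\<close>
  have mult_1: "\<mu>t 1 a b - \<mu>t' 1 a b = \<mu> a (\<phi>t 1 b) + \<mu> (\<phi>t 1 a) b - \<phi>t 1 (\<mu> a b)" for a b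
    using arg_cong[OF mult[of "fps_const a" "fps_const b"], of "\<lambda>x. fps_nth x 1"]
    by (simp add: fps_ext_nth[unfolded One_nat_def] D(3) D'(3) id z algebra_simps)
  \<comment> \<open>The right-hand side is minus \<open>mrba_Psi\<close> of \<open>\<phi>t 1\<close>
    in degree 1.\<close>
  have comm_1: "Rt 1 a - Rt' 1 a = R (\<phi>t 1 a) - \<phi>t 1 (R a)" for a
    using arg_cong[OF comm[of "fps_const a"], of "\<lambda>x. fps_nth x 1"]
    by (simp add: fps_ext_nth[unfolded One_nat_def] D(4) D'(4) id z algebra_simps)
  \<comment> \<open>This is \<open>\<phi>t 1\<close> as a 1-cochain, extended by zero as
    \<open>hom_tensor\<close> demands.\<close>
  define \<chi> where "\<chi> = (\<lambda>as. if length as = 1 then \<phi>t 1 (as ! 0) else 0)"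
  have \<chi>: "\<chi> [a] = \<phi>t 1 a" for a
    by (simp add: \<chi>_def)
  have "module_hom scale scale (\<lambda>b. \<phi>t 1 (bs[0 := b] ! 0))" if "length bs = 1" for bs :: "'a list"
    using that hom[of 1] by simp
  then have "(\<chi>, 0) \<in> mrba_cochains scale scale 1"
    by (auto simp: mrba_cochains_def hom_tensor_def \<chi>_def)
  moreover have "infinitesimal \<mu>t Rt - infinitesimal \<mu>t' Rt' =
    mrba_diff \<kappa> \<mu> R scale \<mu> \<mu> R 1 (\<chi>, 0)"
  proof (rule prod_eqI; rule ext)
    fix bs :: "'a list"
    show "fst (infinitesimal \<mu>t Rt - infinitesimal \<mu>t' Rt') bs =
      fst (mrba_diff \<kappa> \<mu> R scale \<mu> \<mu> R 1 (\<chi>, 0)) bs"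
    proof (cases "length bs = 2")
      case True
      then obtain a b where "bs = [a, b]"
        by (auto simp: length_Suc_conv numeral_2_eq_2)
      then show ?thesis
        using mult_1[of a b] by (simp add: infinitesimal_def mrba_diff_def
            hochschild_diff_1[OF A(1)] \<chi> del: One_nat_def)
    qed (simp add: infinitesimal_def mrba_diff_def hochschild_diff_eq_0)
    show "snd (infinitesimal \<mu>t Rt - infinitesimal \<mu>t' Rt') bs =
      snd (mrba_diff \<kappa> \<mu> R scale \<mu> \<mu> R 1 (\<chi>, 0)) bs"
    proof (cases "length bs = 1")
      case True
      then obtain a where bs: "bs = [a]"
        by (auto simp: length_Suc_conv)
      \<comment> \<open>The second entry of the pair \<open>(\<chi>, 0)\<close> sits in degree 0.
        The tilde actions send 0 to 0, so only the \<open>mrba_Psi\<close> term remains.\<close>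
      have "hochschild_diff (star_mult \<mu> R) scale (tilde_lact R \<mu> R) (tilde_ract R \<mu> R) 0 0 [a] = 0"
        by (simp add: hochschild_diff_def tilde_lact_def tilde_ract_def z
            module.scale_zero_right[OF A(1)])
      then show ?thesis
        using comm_1[of a] bs by (simp add: infinitesimal_def mrba_diff_def
            mrba_Psi_1[OF A(1)] \<chi> del: One_nat_def)
    qed (simp add: infinitesimal_def mrba_diff_def hochschild_diff_eq_0 mrba_Psi_eq_0)
  qed
  ultimately show ?thesis
    by (simp add: mrba_coboundaries_def)
qed

section \<open>Additivity of the differential and equality of cohomology classes\<close>

lemma module_hom_diff:
  assumes "module_hom s1 s2 f" "module_hom s1 s2 g"
  shows "module_hom s1 s2 (\<lambda>x. f x - g x)"
proof -
  have "module_pair s1 s2"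
    using assms(1) by (simp add: module_hom_def module_pair_def)
  then show ?thesis
    using assms by (rule module_pair.module_hom_sub)
qed

lemma hom_tensor_diff:
  assumes "f \<in> hom_tensor scaleB scaleN n" "g \<in> hom_tensor scaleB scaleN n"
  shows "f - g \<in> hom_tensor scaleB scaleN n"
  using assms by (auto simp: hom_tensor_def intro!: module_hom_diff)

lemma mrba_cochains_diff:
  assumes "c \<in> mrba_cochains scaleA scaleM n" "d \<in> mrba_cochains scaleA scaleM n"
  shows "c - d \<in> mrba_cochains scaleA scaleM n"
  using assms by (auto simp: mrba_cochains_def hom_tensor_diff split: if_splits)

text \<open>Stated for arbitrary actions additive in the module argument, so that it serves both the
  actions by \<open>\<mu>\<close> and the tilde actions.\<close>

lemma hochschild_diff_diff:
  assumes "module scale" "\<And>a u v. lact a (u - v) = lact a u - lact a v"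
    and "\<And>a u v. ract (u - v) a = ract u a - ract v a"
  shows "hochschild_diff m scale lact ract n (f - g) =
    hochschild_diff m scale lact ract n f - hochschild_diff m scale lact ract n g"
  by (rule ext) (simp add: hochschild_diff_def assms(2,3) module.scale_right_diff_distrib[OF assms(1)]
      sum_subtractf algebra_simps)

lemma mrba_Psi_diff:
  assumes "module scale" "\<And>u v. S (u - v) = S u - S v"
  shows "mrba_Psi \<kappa> R scale S n (f - g) = mrba_Psi \<kappa> R scale S n f - mrba_Psi \<kappa> R scale S n g"
  by (rule ext) (simp add: mrba_Psi_def Let_def assms(2) module.scale_right_diff_distrib[OF assms(1)]
      sum_subtractf algebra_simps)

lemma mrba_diff_diff:
  assumes "modified_rota_baxter_algebra \<kappa> scale \<mu> R"
  shows "mrba_diff \<kappa> \<mu> R scale \<mu> \<mu> R n (c - d) =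
    mrba_diff \<kappa> \<mu> R scale \<mu> \<mu> R n c - mrba_diff \<kappa> \<mu> R scale \<mu> \<mu> R n d"
proof -
  note A = modified_rota_baxter_algebraD[OF assms]
  note lin = bilinear_map_simps(5,6)[OF A(2)] module_hom.diff[OF A(3)]
  have "hochschild_diff \<mu> scale \<mu> \<mu> n (f - g) =
      hochschild_diff \<mu> scale \<mu> \<mu> n f - hochschild_diff \<mu> scale \<mu> \<mu> n g" for n f g
    by (rule hochschild_diff_diff[OF A(1)]) (simp_all add: lin)
  moreover have "hochschild_diff m scale (tilde_lact R \<mu> R) (tilde_ract R \<mu> R) n (f - g) =
      hochschild_diff m scale (tilde_lact R \<mu> R) (tilde_ract R \<mu> R) n f
      - hochschild_diff m scale (tilde_lact R \<mu> R) (tilde_ract R \<mu> R) n g" for m n f g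
    by (rule hochschild_diff_diff[OF A(1)]) (simp_all add: lin tilde_lact_def tilde_ract_def)
  moreover have "mrba_Psi \<kappa> R scale R n (f - g) =
      mrba_Psi \<kappa> R scale R n f - mrba_Psi \<kappa> R scale R n g" for n f g
    by (rule mrba_Psi_diff[OF A(1)]) (simp add: lin)
  ultimately show ?thesis
    by (cases c; cases d) (simp add: mrba_diff_def)
qed

text \<open>In positive degree the coboundaries are the image of a group under an additive map.
  Closure under subtraction is the form from which symmetry and transitivity of being cohomologous
  follow.\<close>

lemma mrba_coboundaries_diff:
  assumes "modified_rota_baxter_algebra \<kappa> scale \<mu> R"
    and "z \<in> mrba_coboundaries \<kappa> scale \<mu> R scale \<mu> \<mu> R n"
    and "w \<in> mrba_coboundaries \<kappa> scale \<mu> R scale \<mu> \<mu> R n"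
  shows "z - w \<in> mrba_coboundaries \<kappa> scale \<mu> R scale \<mu> \<mu> R n"
proof (cases "n = 0")
  case True
  then show ?thesis
    using assms by (simp add: mrba_coboundaries_def)
next
  case False
  then obtain c d where "c \<in> mrba_cochains scale scale (n - 1)"
    "d \<in> mrba_cochains scale scale (n - 1)"
    "z = mrba_diff \<kappa> \<mu> R scale \<mu> \<mu> R (n - 1) c" "w = mrba_diff \<kappa> \<mu> R scale \<mu> \<mu> R (n - 1) d"
    using assms(2,3) by (auto simp: mrba_coboundaries_def)
  then show ?thesis
    using False
    by (simp add: mrba_coboundaries_def mrba_cochains_diff flip: mrba_diff_diff[OF assms(1)])
qed

lemma mrba_class_eqI:
  assumes "modified_rota_baxter_algebra \<kappa> scale \<mu> R"
    and "z \<in> mrba_cocycles \<kappa> scale \<mu> R scale \<mu> \<mu> R n"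
    and "w \<in> mrba_cocycles \<kappa> scale \<mu> R scale \<mu> \<mu> R n"
    and zw: "z - w \<in> mrba_coboundaries \<kappa> scale \<mu> R scale \<mu> \<mu> R n"
  shows "mrba_class \<kappa> scale \<mu> R scale \<mu> \<mu> R n z = mrba_class \<kappa> scale \<mu> R scale \<mu> \<mu> R n w"
proof -
  note diff = mrba_coboundaries_diff[OF assms(1)]
  have wz: "w - z \<in> mrba_coboundaries \<kappa> scale \<mu> R scale \<mu> \<mu> R n"
    \<comment> \<open>Negation as a double subtraction: \<open>w - z\<close> is
      \<open>((z - w) - (z - w)) - (z - w)\<close>.\<close>
    using diff[OF diff[OF zw zw] zw] by simp
  have "z - c \<in> mrba_coboundaries \<kappa> scale \<mu> R scale \<mu> \<mu> R n \<longleftrightarrow>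
      w - c \<in> mrba_coboundaries \<kappa> scale \<mu> R scale \<mu> \<mu> R n" for c
    \<comment> \<open>Here \<open>(z - c) - (z - w) = w - c\<close> and
      \<open>(w - c) - (w - z) = z - c\<close>.\<close>
    using diff[OF _ zw, of "z - c"] diff[OF _ wz, of "w - c"] by auto
  then show ?thesis
    using assms(2,3) by (auto simp: mrba_class_def mrba_cohomologous_def)
qed

theorem theorem4p3:
  fixes \<kappa> :: "'k::field_char_0"
    and scale :: "'k \<Rightarrow> 'a::ab_group_add \<Rightarrow> 'a"
    and \<mu> :: "'a \<Rightarrow> 'a \<Rightarrow> 'a" and R :: "'a \<Rightarrow> 'a"
    and \<mu>t :: "nat \<Rightarrow> 'a \<Rightarrow> 'a \<Rightarrow> 'a" and Rt :: "nat \<Rightarrow> 'a \<Rightarrow> 'a"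
  assumes "modified_rota_baxter_algebra \<kappa> scale \<mu> R"
    and "formal_deformation \<kappa> scale \<mu> R \<mu>t Rt"
  shows "infinitesimal \<mu>t Rt \<in> mrba_cocycles \<kappa> scale \<mu> R scale \<mu> \<mu> R 2 \<and>
    mrba_class \<kappa> scale \<mu> R scale \<mu> \<mu> R 2 (infinitesimal \<mu>t Rt)
      \<in> mrba_cohomology \<kappa> scale \<mu> R scale \<mu> \<mu> R 2 \<and>
    (\<forall>\<mu>t' Rt'. formal_deformation \<kappa> scale \<mu> R \<mu>t' Rt' \<and>
        equivalent_deformations scale \<mu>t Rt \<mu>t' Rt' \<longrightarrow>
      mrba_class \<kappa> scale \<mu> R scale \<mu> \<mu> R 2 (infinitesimal \<mu>t Rt) =
      mrba_class \<kappa> scale \<mu> R scale \<mu> \<mu> R 2 (infinitesimal \<mu>t' Rt'))"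
proof (intro conjI allI impI)
  note cocycle = infinitesimal_cocycle[OF assms(1)]
  show z: "infinitesimal \<mu>t Rt \<in> mrba_cocycles \<kappa> scale \<mu> R scale \<mu> \<mu> R 2"
    by (rule cocycle[OF assms(2)])
  then show "mrba_class \<kappa> scale \<mu> R scale \<mu> \<mu> R 2 (infinitesimal \<mu>t Rt)
      \<in> mrba_cohomology \<kappa> scale \<mu> R scale \<mu> \<mu> R 2"
    unfolding mrba_class_def mrba_cohomology_def by (rule quotientI)
  fix \<mu>t' Rt'
  assume "formal_deformation \<kappa> scale \<mu> R \<mu>t' Rt' \<and>
    equivalent_deformations scale \<mu>t Rt \<mu>t' Rt'"
  then show "mrba_class \<kappa> scale \<mu> R scale \<mu> \<mu> R 2 (infinitesimal \<mu>t Rt) =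
      mrba_class \<kappa> scale \<mu> R scale \<mu> \<mu> R 2 (infinitesimal \<mu>t' Rt')"
    \<comment> \<open>\<open>cocycle\<close> fixes only the algebra, so it also shows that the
      infinitesimal of the second deformation is a cocycle.\<close>
    using mrba_class_eqI[OF assms(1) z] cocycle equivalent_deformations_coboundary[OF assms]
    by blast
qed

end
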